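(* Let $\lambda_0,\ldots,\lambda_{n-1}$ be nonempty subsets of $[d]=\{1,\ldots,d\}$, let $\Delta_{\lambda_i}=\operatorname{conv}\{e_j: j\in\lambda_i\}\subseteq\mathbb{R}^d$, and let $P=\sum_{i=0}^{n-1}\Delta_{\lambda_i}$ (Minkowski sum). For each $i$ let $F_i$ be a nonempty face of $\Delta_{\lambda_i}$, let $\Pi=(F_0,\ldots,F_{n-1})$ and $F=F_0+\cdots+F_{n-1}$. Then $F$ is a face of $P$ if and only if the directed graph $G_\Pi$ is acyclic (in particular has no loops). Moreover, if $F$ is a face of $P$, then $\dim(F)=d-|[d]/\sim_\Pi|$.
   Context: $e_1,\ldots,e_d$ is the standard basis of $\mathbb{R}^d$. For each $i$ let $V(F_i)=\{a\in[d]: e_a\text{ is a vertex of }F_i\}\subseteq\lambda_i$. The relation $\sim_\Pi$ is the smallest equivalence relation on $[d]$ such that $a\sim_\Pi b$ whenever $a,b\in V(F_i)$ for some $i$; $\bar a$ denotes the class of $a$. The digraph $G_\Pi$ has vertex set $[d]/\sim_\Pi$, and there is an edge $\bar b\to\bar a$ if and only if there is some $i\in\{0,\ldots,n-1\}$ with $\bar b\cap V(F_i)\ne\varnothing$ and $\bar a\cap(\lambda_i\setminus V(F_i))\neq\varnothing$. Loops $\bar a\to\bar a$ are allowed and count as cycles. *)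

theory Defs
  imports "HOL-Analysis.Analysis"
begin

text \<open>
  The index set \<open>[d]\<close> is a finite type \<open>'d\<close>, so \<open>d = CARD('d)\<close> and the ambient space is
  \<open>real ^ 'd\<close> with standard basis vectors \<open>axis j 1\<close>. Minkowski sums are sums of sets in the
  sense of \<open>HOL-Library.Set_Algebras\<close>; the empty sum is \<open>{0}\<close>.
\<close>

definition std_simplex :: "'d::finite set \<Rightarrow> (real ^ 'd) set" where
  "std_simplex L = convex hull ((\<lambda>j. axis j 1) ` L)"

definition vertex_labels :: "(real ^ 'd::finite) set \<Rightarrow> 'd set" where
  "vertex_labels S = {a. axis a 1 extreme_point_of S}"

text \<open>The four rules generate the smallest equivalence relation on the whole of \<open>[d]\<close>; indices in
  no \<open>V(F\<^sub>i)\<close> form singleton classes.\<close>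

inductive_set face_equiv :: "nat \<Rightarrow> (nat \<Rightarrow> (real ^ 'd::finite) set) \<Rightarrow> ('d \<times> 'd) set"
  for n :: nat and F :: "nat \<Rightarrow> (real ^ 'd) set" where
  base: "\<lbrakk>i < n; a \<in> vertex_labels (F i); b \<in> vertex_labels (F i)\<rbrakk> \<Longrightarrow> (a, b) \<in> face_equiv n F"
| refl: "(a, a) \<in> face_equiv n F"
| sym: "(a, b) \<in> face_equiv n F \<Longrightarrow> (b, a) \<in> face_equiv n F"
| trans: "\<lbrakk>(a, b) \<in> face_equiv n F; (b, c) \<in> face_equiv n F\<rbrakk> \<Longrightarrow> (a, c) \<in> face_equiv n F"

definition face_classes :: "nat \<Rightarrow> (nat \<Rightarrow> (real ^ 'd::finite) set) \<Rightarrow> 'd set set" where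
  "face_classes n F = UNIV // face_equiv n F"

text \<open>The edge relation of \<open>G\<^sub>\<Pi>\<close>: the pair \<open>(B, A)\<close> is the edge from \<open>B\<close> to \<open>A\<close>. Pairs \<open>(A, A)\<close>
  are loops, and \<^const>\<open>acyclic\<close> excludes them.\<close>

definition face_digraph ::
    "nat \<Rightarrow> (nat \<Rightarrow> 'd::finite set) \<Rightarrow> (nat \<Rightarrow> (real ^ 'd) set) \<Rightarrow> ('d set \<times> 'd set) set" where
  "face_digraph n L F =
    {(B, A). B \<in> face_classes n F \<and> A \<in> face_classes n F \<and>
       (\<exists>i<n. B \<inter> vertex_labels (F i) \<noteq> {} \<and> A \<inter> (L i - vertex_labels (F i)) \<noteq> {})}"

end

theory Submission
  imports Defs
begin

text \<open>
  A sum of simplex faces is a face of the sum of simplices iff some linear functional \<open>w\<close> exposes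
  every summand simultaneously. Since \<open>F\<^sub>i\<close> is the simplex on \<open>V(F\<^sub>i)\<close>, this says that \<open>w\<close> is constant
  on each \<open>V(F\<^sub>i)\<close> and strictly smaller on \<open>\<lambda>\<^sub>i \<setminus> V(F\<^sub>i)\<close>; so \<open>w\<close> descends to the classes of \<open>\<sim>\<^sub>\<Pi>\<close> and
  decreases along the edges of \<open>G\<^sub>\<Pi>\<close>. Such a potential exists iff \<open>G\<^sub>\<Pi>\<close> is acyclic, the number of
  descendants of a vertex being one. For the dimension, the vectors orthogonal to all differences
  of points of \<open>F\<close> are those constant on the classes of \<open>\<sim>\<^sub>\<Pi>\<close>.
\<close>

section \<open>Standard simplices and their faces\<close>

text \<open>The right-hand side is convex and contains the generators; conversely, the expansion of
  one of its points in the standard basis is itself a convex combination of generators.\<close>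

lemma std_simplex_altdef:
  "std_simplex L = {x. (\<forall>i. 0 \<le> x $ i) \<and> (\<forall>i. i \<notin> L \<longrightarrow> x $ i = 0) \<and> (\<Sum>i\<in>UNIV. x $ i) = 1}"
    (is "_ = ?S")
proof
  have "convex ?S"
    by (auto simp: convex_def sum.distrib simp flip: sum_distrib_left)
  moreover have "(\<lambda>j. axis j 1) ` L \<subseteq> ?S"
    by (auto simp: axis_def)
  ultimately show "std_simplex L \<subseteq> ?S"
    unfolding std_simplex_def by (rule hull_minimal[rotated])
next
  show "?S \<subseteq> std_simplex L"
  proof
    fix x assume x: "x \<in> ?S"
    have "x = (\<Sum>i\<in>UNIV. x $ i *\<^sub>R axis i 1)"
      using basis_expansion[of x] by (simp add: scalar_mult_eq_scaleR)
    also have "\<dots> = (\<Sum>i\<in>L. x $ i *\<^sub>R axis i 1)"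
      using x by (intro sum.mono_neutral_right) auto
    also have "\<dots> \<in> std_simplex L"
      unfolding std_simplex_def
    proof (rule convex_sum)
      have "(\<Sum>i\<in>L. x $ i) = (\<Sum>i\<in>UNIV. x $ i)"
        using x by (intro sum.mono_neutral_left) auto
      then show "(\<Sum>i\<in>L. x $ i) = 1" using x by simp
    qed (use x in \<open>auto intro: hull_inc\<close>)
    finally show "x \<in> std_simplex L" .
  qed
qed

lemma axis_in_std_simplex [simp]: "axis a 1 \<in> std_simplex L \<longleftrightarrow> a \<in> L"
  by (auto simp: std_simplex_altdef axis_def)

lemma std_simplex_nth_le_one: "x \<in> std_simplex L \<Longrightarrow> x $ i \<le> 1"
  unfolding std_simplex_altdef by (metis (mono_tags, lifting) UNIV_I finite member_le_sum mem_Collect_eq)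

text \<open>Affine independence makes every generator an extreme point of the hull, which lets
  \<open>vertex_labels\<close> recover \<open>L\<close> from \<open>std_simplex L\<close>.\<close>

lemma not_affine_dependent_axis:
  "\<not> affine_dependent ((\<lambda>j. axis j (1::real)) ` (L :: 'd::finite set))"
proof
  assume "affine_dependent ((\<lambda>j. axis j (1::real)) ` L)"
  then have "dependent ((\<lambda>j. axis j (1::real)) ` L)"
    by (rule affine_dependent_imp_dependent)
  moreover have "(\<lambda>j. axis j (1::real)) ` L \<subseteq> Basis"
    by (auto simp: axis_in_Basis_iff)
  ultimately show False
    using independent_Basis dependent_mono by blast
qed

lemma vertex_labels_std_simplex [simp]: "vertex_labels (std_simplex L) = L"
  unfolding vertex_labels_def std_simplex_def
  by (auto simp: extreme_point_of_convex_hull_affine_independent[OF not_affine_dependent_axis]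
      axis_eq_axis)

text \<open>A face of the hull of a finite set is the hull of a subset of it, here of the basis
  vectors of some \<open>V\<close>, and \<open>vertex_labels\<close> returns that \<open>V\<close>.
  From here on, faces can be handled as sets of labels.\<close>

lemma face_of_std_simplex:
  assumes "T face_of std_simplex L"
  shows "T = std_simplex (vertex_labels T)" and "vertex_labels T \<subseteq> L"
proof -
  obtain S' where "S' \<subseteq> (\<lambda>j. axis j 1) ` L" "T = convex hull S'"
    using face_of_convex_hull_subset[of "(\<lambda>j. axis j 1) ` L" T] assms
    by (auto simp: std_simplex_def finite_imp_compact)
  then obtain V where V: "V \<subseteq> L" "T = std_simplex V"
    by (metis std_simplex_def subset_imageE)
  then show "T = std_simplex (vertex_labels T)" "vertex_labels T \<subseteq> L"
    by simp_all
qed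

lemma std_simplex_empty [simp]: "std_simplex {} = {}"
  by (simp add: std_simplex_def)

lemma convex_std_simplex [simp]: "convex (std_simplex L)"
  by (simp add: std_simplex_def)

lemma inner_std_simplex_le:
  assumes "x \<in> std_simplex L" and "\<And>a. a \<in> L \<Longrightarrow> w $ a \<le> m"
  shows "w \<bullet> x \<le> m"
proof -
  have "std_simplex L \<subseteq> {x. w \<bullet> x \<le> m}"
    unfolding std_simplex_def using assms(2)
    by (intro hull_minimal convex_halfspace_le) (auto simp: inner_axis)
  then show ?thesis using assms(1) by auto
qed

lemma inner_std_simplex_eq:
  assumes "x \<in> std_simplex L" and "\<And>a. a \<in> L \<Longrightarrow> w $ a = m"
  shows "w \<bullet> x = m"
proof -
  have "w \<bullet> x \<le> m"
    using assms by (intro inner_std_simplex_le[of x L]) auto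
  moreover have "(- w) \<bullet> x \<le> - m"
    using assms by (intro inner_std_simplex_le[of x L]) auto
  ultimately show ?thesis by simp
qed

text \<open>Since the coordinates of \<open>x\<close> sum to one, \<open>m - w \<bullet> x\<close>
  is the sum of the nonnegative terms \<open>(m - w $ i) * x $ i\<close>. It vanishes only if each
  term does, which forces \<open>x $ i = 0\<close> wherever \<open>w $ i < m\<close>.\<close>

lemma std_simplex_Int_hyperplane:
  assumes V: "V \<subseteq> L" and eq: "\<And>a. a \<in> V \<Longrightarrow> w $ a = m"
    and less: "\<And>c. c \<in> L - V \<Longrightarrow> w $ c < m"
  shows "std_simplex V = std_simplex L \<inter> {x. w \<bullet> x = m}"
proof
  show "std_simplex V \<subseteq> std_simplex L \<inter> {x. w \<bullet> x = m}"
    using V inner_std_simplex_eq[of _ V w m] eq by (auto simp: std_simplex_altdef)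
next
  show "std_simplex L \<inter> {x. w \<bullet> x = m} \<subseteq> std_simplex V"
  proof
    fix x assume "x \<in> std_simplex L \<inter> {x. w \<bullet> x = m}"
    then have x: "x \<in> std_simplex L" and wx: "w \<bullet> x = m" by auto
    \<comment> \<open>The first factor is zero on \<open>V\<close> and positive on
      \<open>L - V\<close>; outside \<open>L\<close>, where its sign is unknown, the second factor
      is zero.\<close>
    have nn: "0 \<le> (m - w $ i) * x $ i" for i
      using x eq less V by (cases "i \<in> L"; cases "i \<in> V") (auto simp: std_simplex_altdef less_imp_le)
    have "(\<Sum>i\<in>UNIV. (m - w $ i) * x $ i) = m * (\<Sum>i\<in>UNIV. x $ i) - w \<bullet> x"
      by (simp add: algebra_simps sum_subtractf inner_vec_def sum_distrib_left)
    also have "\<dots> = 0"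
      using x wx by (simp add: std_simplex_altdef)
    finally have zero: "(m - w $ i) * x $ i = 0" for i
      using nn by (simp add: sum_nonneg_eq_0_iff)
    have "x $ i = 0" if "i \<notin> V" for i
      using that zero[of i] less[of i] x by (cases "i \<in> L") (auto simp: std_simplex_altdef)
    then show "x \<in> std_simplex V"
      using x by (auto simp: std_simplex_altdef)
  qed
qed

section \<open>Faces of Minkowski sums of simplices\<close>

text \<open>A sum of terms bounded by \<open>m i\<close> reaches \<open>sum m I\<close> only if
  every term reaches its own bound, so maximising \<open>w\<close> commutes with Minkowski
  sums.\<close>

lemma set_sum_Int_hyperplane:
  fixes w :: "'a::real_inner"
  assumes "finite I" and le: "\<And>i x. i \<in> I \<Longrightarrow> x \<in> S i \<Longrightarrow> w \<bullet> x \<le> m i"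
  shows "(\<Sum>i\<in>I. S i \<inter> {x. w \<bullet> x = m i}) = (\<Sum>i\<in>I. S i) \<inter> {x. w \<bullet> x = sum m I}"
proof
  show "(\<Sum>i\<in>I. S i \<inter> {x. w \<bullet> x = m i}) \<subseteq> (\<Sum>i\<in>I. S i) \<inter> {x. w \<bullet> x = sum m I}"
    using \<open>finite I\<close> by (auto simp: set_sum_alt inner_sum_right)
next
  show "(\<Sum>i\<in>I. S i) \<inter> {x. w \<bullet> x = sum m I} \<subseteq> (\<Sum>i\<in>I. S i \<inter> {x. w \<bullet> x = m i})"
  proof
    fix x assume "x \<in> (\<Sum>i\<in>I. S i) \<inter> {x. w \<bullet> x = sum m I}"
    then obtain s where s: "x = sum s I" "\<And>i. i \<in> I \<Longrightarrow> s i \<in> S i" and "w \<bullet> x = sum m I"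
      using \<open>finite I\<close> by (auto simp: set_sum_alt)
    then have "(\<Sum>i\<in>I. m i - w \<bullet> s i) = 0"
      by (simp add: sum_subtractf inner_sum_right)
    then have "\<forall>i\<in>I. w \<bullet> s i = m i"
      using \<open>finite I\<close> le s(2) by (subst (asm) sum_nonneg_eq_0_iff) auto
    then show "x \<in> (\<Sum>i\<in>I. S i \<inter> {x. w \<bullet> x = m i})"
      using s \<open>finite I\<close> by (auto simp: set_sum_alt)
  qed
qed

lemma sum_std_simplex_face_of:
  fixes w :: "real ^ 'd::finite"
  assumes "finite I" and V: "\<And>i. i \<in> I \<Longrightarrow> V i \<subseteq> L i" "\<And>i. i \<in> I \<Longrightarrow> V i \<noteq> {}"
    and eq: "\<And>i a b. \<lbrakk>i \<in> I; a \<in> V i; b \<in> V i\<rbrakk> \<Longrightarrow> w $ a = w $ b"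
    and less: "\<And>i a c. \<lbrakk>i \<in> I; a \<in> V i; c \<in> L i - V i\<rbrakk> \<Longrightarrow> w $ c < w $ a"
  shows "(\<Sum>i\<in>I. std_simplex (V i)) face_of (\<Sum>i\<in>I. std_simplex (L i))"
proof -
  \<comment> \<open>The common value of \<open>w\<close> on \<open>V i\<close>, which is also its
    maximum on \<open>L i\<close>.\<close>
  define m where "m i = w $ (SOME a. a \<in> V i)" for i
  have m: "w $ a = m i" if "i \<in> I" "a \<in> V i" for i a
    unfolding m_def using eq that by (metis someI)
  have m_less: "w $ c < m i" if i: "i \<in> I" and c: "c \<in> L i - V i" for i c
  proof -
    obtain a where "a \<in> V i" using V(2) i by blast
    then show ?thesis using m[OF i] less[OF i _ c] by metis
  qed
  have "w $ a \<le> m i" if "i \<in> I" "a \<in> L i" for i a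
    using m[of i a] m_less[of i a] that by (cases "a \<in> V i") auto
  then have le: "w \<bullet> x \<le> m i" if "i \<in> I" "x \<in> std_simplex (L i)" for i x
    using that by (blast intro: inner_std_simplex_le)
  have "(\<Sum>i\<in>I. std_simplex (V i)) = (\<Sum>i\<in>I. std_simplex (L i) \<inter> {x. w \<bullet> x = m i})"
    using m m_less V(1) by (intro sum.cong std_simplex_Int_hyperplane) auto
  also have "\<dots> = (\<Sum>i\<in>I. std_simplex (L i)) \<inter> {x. w \<bullet> x = sum m I}"
    using \<open>finite I\<close> le by (rule set_sum_Int_hyperplane)
  also have "\<dots> face_of (\<Sum>i\<in>I. std_simplex (L i))"
  proof (rule face_of_Int_supporting_hyperplane_le)
    show "w \<bullet> x \<le> sum m I" if "x \<in> (\<Sum>i\<in>I. std_simplex (L i))" for x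
      using that le \<open>finite I\<close> by (auto simp: set_sum_alt inner_sum_right intro!: sum_mono)
  qed (simp add: convex_set_sum)
  finally show ?thesis .
qed

text \<open>The sum of the hulls is the hull of the finite sum set. Being a polyhedron guarantees
  that every face is exposed by a linear functional.\<close>

lemma polyhedron_sum_std_simplex: "polyhedron (\<Sum>i\<in>I. std_simplex (L i))"
  unfolding std_simplex_def convex_hull_set_sum[symmetric]
  by (intro polytope_imp_polyhedron polytope_convex_hull finite_set_sum) auto

text \<open>The functional \<open>w\<close> exposing the sum works for every summand: exchanging one
  vertex in a sum of vertices shows that \<open>w\<close> is maximal over \<open>L i\<close> on
  \<open>V i\<close>. Strictness outside \<open>V i\<close> needs a further argument, because
  equality only yields another point of the sum of the smaller simplices.\<close>

lemma sum_std_simplex_face_ofD: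
  fixes V L :: "'i \<Rightarrow> 'd::finite set"
  assumes "finite I" and V: "\<And>i. i \<in> I \<Longrightarrow> V i \<subseteq> L i" "\<And>i. i \<in> I \<Longrightarrow> V i \<noteq> {}"
    and face: "(\<Sum>i\<in>I. std_simplex (V i)) face_of (\<Sum>i\<in>I. std_simplex (L i))"
  obtains w :: "real ^ 'd"
  where "\<And>i a b. \<lbrakk>i \<in> I; a \<in> V i; b \<in> V i\<rbrakk> \<Longrightarrow> w $ a = w $ b"
    and "\<And>i a c. \<lbrakk>i \<in> I; a \<in> V i; c \<in> L i - V i\<rbrakk> \<Longrightarrow> w $ c < w $ a"
proof -
  let ?P = "\<Sum>i\<in>I. std_simplex (L i)" and ?F = "\<Sum>i\<in>I. std_simplex (V i)"
  have "?F exposed_face_of ?P"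
    using face polyhedron_sum_std_simplex exposed_face_of_polyhedron by blast
  then obtain w b where P_le: "\<And>x. x \<in> ?P \<Longrightarrow> w \<bullet> x \<le> b" and F_eq: "?F = ?P \<inter> {x. w \<bullet> x = b}"
    unfolding exposed_face_of_def by blast
  \<comment> \<open>Exchanging \<open>f i\<close> for \<open>c\<close> changes the value
    \<open>b\<close> of \<open>w\<close> by \<open>w $ c - w $ (f i)\<close>. The bound on
    \<open>?P\<close> makes this change nonpositive, and a zero change keeps the point in
    \<open>?F\<close>.\<close>
  have replace: "w $ c \<le> w $ (f i) \<and> (w $ c = w $ (f i) \<longrightarrow> (\<Sum>j\<in>I. axis ((f(i := c)) j) 1) \<in> ?F)"
    if i: "i \<in> I" and c: "c \<in> L i" and f: "\<And>j. j \<in> I \<Longrightarrow> f j \<in> V j" for i c and f :: "'i \<Rightarrow> 'd"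
  proof -
    let ?y = "\<Sum>j\<in>I. axis ((f(i := c)) j) 1 :: real ^ 'd"
    have "(\<Sum>j\<in>I. axis (f j) 1) \<in> ?F"
      using f \<open>finite I\<close> by (force simp: set_sum_alt)
    then have "w \<bullet> (\<Sum>j\<in>I. axis (f j) 1) = b"
      using F_eq by auto
    then have "(\<Sum>j\<in>I. w $ (f j)) = b"
      by (simp add: inner_sum_right inner_axis)
    moreover have "w \<bullet> ?y = (\<Sum>j\<in>I. w $ ((f(i := c)) j))"
      by (simp add: inner_sum_right inner_axis)
    ultimately have "w \<bullet> ?y = b + w $ c - w $ (f i)"
      using i \<open>finite I\<close> by (simp add: sum.remove)
    moreover have y: "?y \<in> ?P"
      using f c V(1) \<open>finite I\<close> by (force simp: set_sum_alt)
    ultimately show ?thesis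
      using P_le[OF y] F_eq by simp
  qed
  have le: "w $ c \<le> w $ a" if i: "i \<in> I" and a: "a \<in> V i" and c: "c \<in> L i" for i a c
    using replace[OF i c, of "\<lambda>j. if j = i then a else SOME b. b \<in> V j"] V(2) a
    by (simp add: some_in_eq)
  show ?thesis
  proof
    show "w $ a = w $ b" if "i \<in> I" "a \<in> V i" "b \<in> V i" for i a b
      using le that V(1) by (meson antisym subsetD)
    show "w $ c < w $ a" if i: "i \<in> I" and a: "a \<in> V i" and c: "c \<in> L i - V i" for i a c
    proof (rule ccontr)
      assume "\<not> w $ c < w $ a"
      then have wc: "w $ c = w $ a"
        using le[OF i a] c by (simp add: antisym)
      \<comment> \<open>Away from \<open>i\<close>, this choice maximises the coordinate \<open>c\<close> over each \<open>F\<^sub>j\<close>; putting \<open>c\<close> at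
        position \<open>i\<close> then gives a point whose coordinate \<open>c\<close> is too large for \<open>F\<close>.\<close>
      define f where
        "f j = (if j = i then a else if c \<in> V j then c else SOME b. b \<in> V j)" for j
      have f: "f j \<in> V j" if "j \<in> I" for j
        using that V(2) a by (auto simp: f_def some_in_eq)
      have "(\<Sum>j\<in>I. axis ((f(i := c)) j) 1) \<in> ?F"
        using replace[OF i, of c f] c f wc by (auto simp: f_def)
      then obtain g where g: "\<And>j. j \<in> I \<Longrightarrow> g j \<in> std_simplex (V j)"
        and sum_eq: "(\<Sum>j\<in>I. axis ((f(i := c)) j) 1) = sum g I"
        using \<open>finite I\<close> by (auto simp: set_sum_alt)
      have "(\<Sum>j\<in>I. g j $ c) < (\<Sum>j\<in>I. (axis ((f(i := c)) j) 1 :: real ^ 'd) $ c)"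
      proof (rule sum_strict_mono_ex1[OF \<open>finite I\<close>])
        show "\<forall>j\<in>I. g j $ c \<le> (axis ((f(i := c)) j) 1 :: real ^ 'd) $ c"
        proof
          fix j assume j: "j \<in> I"
          show "g j $ c \<le> (axis ((f(i := c)) j) 1 :: real ^ 'd) $ c"
          proof (cases "j = i \<or> c \<in> V j")
            case True
            then show ?thesis
              using std_simplex_nth_le_one[OF g[OF j], of c] by (auto simp: f_def)
          next
            case False
            then show ?thesis
              using g[OF j] by (simp add: std_simplex_altdef axis_def)
          qed
        qed
        \<comment> \<open>Strictness comes from position \<open>i\<close>: \<open>c\<close> is not
          in \<open>V i\<close>, so \<open>g i\<close> contributes 0 where the exchanged vertex
          contributes 1.\<close>
        have "g i $ c = 0"
          using g[OF i] c by (simp add: std_simplex_altdef)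
        then show "\<exists>j\<in>I. g j $ c < (axis ((f(i := c)) j) 1 :: real ^ 'd) $ c"
          using i by (intro bexI[of _ i]) auto
      qed
      then show False
        using arg_cong[OF sum_eq, of "\<lambda>x. x $ c"] by (simp add: sum_component)
    qed
  qed
qed

section \<open>Equivalence classes, acyclicity and potentials\<close>

lemma equiv_face_equiv: "equiv UNIV (face_equiv n F)"
  by (rule equivI) (auto simp: refl_on_def intro!: symI transI intro: face_equiv.intros)

text \<open>Agreement under \<open>w\<close> is itself an equivalence relation, so it contains the
  one generated. This lets \<open>w\<close> descend to the classes.\<close>

lemma face_equiv_const:
  assumes "(a, b) \<in> face_equiv n F"
    and "\<And>i a b. \<lbrakk>i < n; a \<in> vertex_labels (F i); b \<in> vertex_labels (F i)\<rbrakk> \<Longrightarrow> w a = w b"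
  shows "w a = w b"
  using assms(1)
proof induction
  case (base i a b)
  then show ?case by (rule assms(2))
qed simp_all

lemma acyclic_iff_potential:
  fixes r :: "('a::finite \<times> 'a) set"
  shows "acyclic r \<longleftrightarrow> (\<exists>p :: 'a \<Rightarrow> nat. \<forall>(x, y)\<in>r. p y < p x)"
proof
  assume r: "acyclic r"
  \<comment> \<open>The inclusion is strict because \<open>y\<close> is a descendant of
    \<open>x\<close> but, by acyclicity, not of itself.\<close>
  have "r\<^sup>+ `` {y} \<subset> r\<^sup>+ `` {x}" if "(x, y) \<in> r" for x y
    using that r by (auto simp: acyclic_def intro: trancl_into_trancl2)
  then show "\<exists>p :: 'a \<Rightarrow> nat. \<forall>(x, y)\<in>r. p y < p x"
    by (intro exI[of _ "\<lambda>x. card (r\<^sup>+ `` {x})"]) (auto intro!: psubset_card_mono)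
next
  assume "\<exists>p :: 'a \<Rightarrow> nat. \<forall>(x, y)\<in>r. p y < p x"
  then obtain p :: "'a \<Rightarrow> nat" where p: "\<And>x y. (x, y) \<in> r \<Longrightarrow> p y < p x" by auto
  have "p y < p x" if "(x, y) \<in> r\<^sup>+" for x y
    using that by induction (auto dest: p)
  then show "acyclic r"
    by (auto simp: acyclic_def)
qed

lemma face_digraph_edgeI:
  assumes "i < n" "a \<in> vertex_labels (F i)" "c \<in> L i - vertex_labels (F i)"
  shows "(face_equiv n F `` {a}, face_equiv n F `` {c}) \<in> face_digraph n L F"
  using assms by (auto simp: face_digraph_def face_classes_def quotient_def intro: face_equiv.refl)

text \<open>A potential on the classes is pulled back to labels to give \<open>w\<close>. In the
  other direction \<open>w\<close> is real-valued, whereas \<open>acyclic_iff_potential\<close> asks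
  for natural numbers, so the decrease is followed along paths directly.\<close>

lemma acyclic_face_digraph_iff:
  fixes F :: "nat \<Rightarrow> (real ^ 'd::finite) set"
  shows "acyclic (face_digraph n L F) \<longleftrightarrow>
    (\<exists>w :: real ^ 'd. \<forall>i<n. \<forall>a\<in>vertex_labels (F i).
       (\<forall>b\<in>vertex_labels (F i). w $ a = w $ b) \<and>
       (\<forall>c\<in>L i - vertex_labels (F i). w $ c < w $ a))"
proof
  assume "acyclic (face_digraph n L F)"
  then obtain p :: "'d set \<Rightarrow> nat" where p: "\<And>B A. (B, A) \<in> face_digraph n L F \<Longrightarrow> p A < p B"
    unfolding acyclic_iff_potential by auto
  define w :: "real ^ 'd" where "w = (\<chi> a. real (p (face_equiv n F `` {a})))"
  have "w $ a = w $ b" if "i < n" "a \<in> vertex_labels (F i)" "b \<in> vertex_labels (F i)" for i a b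
    using equiv_class_eq[OF equiv_face_equiv face_equiv.base[of i n a F b, OF that]] by (simp add: w_def)
  moreover have "w $ c < w $ a"
    if "i < n" "a \<in> vertex_labels (F i)" "c \<in> L i - vertex_labels (F i)" for i a c
    using p[OF face_digraph_edgeI[of i n a F c L, OF that]] by (simp add: w_def)
  ultimately show "\<exists>w :: real ^ 'd. \<forall>i<n. \<forall>a\<in>vertex_labels (F i).
       (\<forall>b\<in>vertex_labels (F i). w $ a = w $ b) \<and>
       (\<forall>c\<in>L i - vertex_labels (F i). w $ c < w $ a)"
    by blast
next
  assume "\<exists>w :: real ^ 'd. \<forall>i<n. \<forall>a\<in>vertex_labels (F i).
       (\<forall>b\<in>vertex_labels (F i). w $ a = w $ b) \<and>
       (\<forall>c\<in>L i - vertex_labels (F i). w $ c < w $ a)"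
  then obtain w :: "real ^ 'd" where
    eq: "\<And>i a b. \<lbrakk>i < n; a \<in> vertex_labels (F i); b \<in> vertex_labels (F i)\<rbrakk> \<Longrightarrow> w $ a = w $ b" and
    less: "\<And>i a c. \<lbrakk>i < n; a \<in> vertex_labels (F i); c \<in> L i - vertex_labels (F i)\<rbrakk> \<Longrightarrow> w $ c < w $ a"
    by metis
  have const: "w $ a = w $ b" if "A \<in> face_classes n F" "a \<in> A" "b \<in> A" for A a b
  proof (rule face_equiv_const)
    show "(a, b) \<in> face_equiv n F"
      using that in_quotient_imp_in_rel[OF equiv_face_equiv, of A n F a b]
      by (simp add: face_classes_def)
  qed (rule eq)
  have edge: "w $ a < w $ b" if "(B, A) \<in> face_digraph n L F" "b \<in> B" "a \<in> A" for A B a b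
  proof -
    from that(1) have classes: "B \<in> face_classes n F" "A \<in> face_classes n F"
      and "\<exists>i<n. B \<inter> vertex_labels (F i) \<noteq> {} \<and> A \<inter> (L i - vertex_labels (F i)) \<noteq> {}"
      by (simp_all add: face_digraph_def)
    then obtain i b' a' where "i < n" "b' \<in> B" "b' \<in> vertex_labels (F i)"
      "a' \<in> A" "a' \<in> L i - vertex_labels (F i)"
      by blast
    with classes show ?thesis
      using less[of i b' a'] const[of B b b'] const[of A a a'] that by simp
  qed
  have nonempty: "A \<noteq> {}" if "(B, A) \<in> face_digraph n L F" for A B
    using that unfolding face_digraph_def by auto
  \<comment> \<open>Nonemptiness is carried along so that the inequality is not vacuous: it supplies
    the intermediate label when a path is extended, and on a closed path a label \<open>a\<close>
    with \<open>w $ a < w $ a\<close>.\<close>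
  have "A \<noteq> {} \<and> (\<forall>b\<in>B. \<forall>a\<in>A. w $ a < w $ b)" if "(B, A) \<in> (face_digraph n L F)\<^sup>+" for A B
    using that
  proof induction
    case (base A)
    then show ?case using edge nonempty by blast
  next
    case (step A C)
    then obtain a where "a \<in> A" by blast
    then show ?case
      using step edge[OF step(2)] nonempty[OF step(2)] by (meson less_trans)
  qed
  then show "acyclic (face_digraph n L F)"
    unfolding acyclic_def by (metis all_not_in_conv less_irrefl)
qed

section \<open>The dimension formula\<close>

text \<open>After translating a point \<open>p\<close> of \<open>S\<close> to the origin,
  \<open>aff_dim S\<close> is the dimension of a span. The vectors \<open>u\<close> constant on
  \<open>S\<close> form the orthogonal complement of that span.\<close>

lemma aff_dim_eq_DIM_minus_dim_orthogonal:
  fixes S :: "'a::euclidean_space set"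
  assumes "S \<noteq> {}"
  shows "aff_dim S = int DIM('a) - int (dim {u. \<forall>x\<in>S. \<forall>y\<in>S. u \<bullet> x = u \<bullet> y})"
proof -
  obtain p where p: "p \<in> S" using assms by blast
  let ?D = "(+) (- p) ` S"
  have "dim {u \<in> UNIV. \<forall>d\<in>span ?D. orthogonal d u} + dim (span ?D) = dim (UNIV :: 'a set)"
    by (rule dim_subspace_orthogonal_to_vectors) auto
  moreover have "{u \<in> UNIV. \<forall>d\<in>span ?D. orthogonal d u} = {u. \<forall>x\<in>S. \<forall>y\<in>S. u \<bullet> x = u \<bullet> y}"
  proof -
    have "(\<forall>d\<in>span ?D. orthogonal d u) \<longleftrightarrow> (\<forall>d\<in>?D. orthogonal u d)" for u
      using orthogonal_to_span[where S = ?D and x = u] by (metis orthogonal_commute span_base)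
    moreover have "(\<forall>d\<in>?D. orthogonal u d) \<longleftrightarrow> (\<forall>x\<in>S. u \<bullet> x = u \<bullet> p)" for u
      by (auto simp: orthogonal_def inner_diff_right algebra_simps)
    moreover have "(\<forall>x\<in>S. u \<bullet> x = u \<bullet> p) \<longleftrightarrow> (\<forall>x\<in>S. \<forall>y\<in>S. u \<bullet> x = u \<bullet> y)" for u
      using p by metis
    ultimately show ?thesis by simp
  qed
  moreover have "aff_dim S = int (dim ?D)"
    using p by (intro aff_dim_eq_dim hull_inc)
  ultimately show ?thesis by simp
qed

text \<open>The indicator vectors of the classes form a basis: they are nonzero and, having disjoint
  supports, pairwise orthogonal, hence independent.\<close>

lemma dim_const_on_classes:
  assumes r: "equiv (UNIV :: 'd::finite set) r"
  shows "dim {u :: real ^ 'd. \<forall>(a, b)\<in>r. u $ a = u $ b} = card (UNIV // r)"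
proof -
  define ind :: "'d set \<Rightarrow> real ^ 'd" where "ind C = (\<chi> a. of_bool (a \<in> C))" for C
  let ?Q = "UNIV // r" and ?U = "{u :: real ^ 'd. \<forall>(a, b)\<in>r. u $ a = u $ b}"
  have inj: "inj_on ind A" for A
    by (rule inj_onI) (simp add: ind_def vec_eq_iff set_eq_iff of_bool_eq_iff)
  have "pairwise orthogonal (ind ` ?Q)"
  proof (rule pairwiseI; clarify)
    fix B C assume "B \<in> ?Q" "C \<in> ?Q" "ind B \<noteq> ind C"
    then have "B \<inter> C = {}"
      using quotient_disj[OF r] by blast
    then show "orthogonal (ind B) (ind C)"
      by (auto simp: orthogonal_def inner_vec_def ind_def intro!: sum.neutral)
  qed
  moreover have "0 \<notin> ind ` ?Q"
  proof
    assume "0 \<in> ind ` ?Q"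
    then obtain C where "C \<in> ?Q" "ind C = 0" by auto
    moreover obtain a where "a \<in> C"
      using in_quotient_imp_non_empty[OF r \<open>C \<in> ?Q\<close>] by blast
    ultimately show False
      by (auto simp: ind_def vec_eq_iff)
  qed
  ultimately have "independent (ind ` ?Q)"
    by (rule pairwise_orthogonal_independent)
  moreover have "ind ` ?Q \<subseteq> ?U"
  proof clarify
    fix C a b assume "C \<in> ?Q" "(a, b) \<in> r"
    then have "a \<in> C \<longleftrightarrow> b \<in> C"
      using in_quotient_imp_closed[OF r] r by (meson equivE symE)
    then show "ind C $ a = ind C $ b"
      by (simp add: ind_def)
  qed
  moreover have "?U \<subseteq> span (ind ` ?Q)"
  proof
    fix u assume u: "u \<in> ?U"
    \<comment> \<open>Each coefficient is the value of \<open>u\<close> at a chosen representative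
      of the class; at coordinate \<open>a\<close> only the class of \<open>a\<close>
      contributes.\<close>
    have "u = (\<Sum>C\<in>?Q. u $ (SOME a. a \<in> C) *\<^sub>R ind C)"
    proof (rule vec_eq_iff[THEN iffD2], rule allI)
      fix a
      let ?A = "r `` {a}"
      have A: "?A \<in> ?Q" "a \<in> ?A"
        by (rule quotientI[OF UNIV_I], rule equiv_class_self[OF r UNIV_I])
      have unique: "C = ?A" if "C \<in> ?Q" "a \<in> C" for C
        using quotient_disj[OF r that(1) A(1)] that(2) A(2) by blast
      have "(\<Sum>C\<in>?Q. u $ (SOME a. a \<in> C) *\<^sub>R ind C) $ a
          = (\<Sum>C\<in>?Q. if C = ?A then u $ (SOME a. a \<in> ?A) else 0)"
        unfolding sum_component
      proof (rule sum.cong[OF HOL.refl])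
        fix C assume C: "C \<in> ?Q"
        show "(u $ (SOME a. a \<in> C) *\<^sub>R ind C) $ a = (if C = ?A then u $ (SOME a. a \<in> ?A) else 0)"
        proof (cases "C = ?A")
          case True
          then show ?thesis using A(2) by (simp add: ind_def)
        next
          case False
          then have "a \<notin> C" using unique[OF C] by blast
          with False show ?thesis by (simp add: ind_def)
        qed
      qed
      also have "\<dots> = u $ (SOME a. a \<in> ?A)"
        using A(1) by simp
      also have "(a, SOME a. a \<in> ?A) \<in> r"
        using someI[of "\<lambda>b. b \<in> ?A", OF A(2)] by simp
      then have "u $ (SOME a. a \<in> ?A) = u $ a"
        using u by force
      finally show "u $ a = (\<Sum>C\<in>?Q. u $ (SOME a. a \<in> C) *\<^sub>R ind C) $ a" by simp
    qed
    also have "\<dots> \<in> span (ind ` ?Q)"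
      by (intro span_sum span_scale span_base) auto
    finally show "u \<in> span (ind ` ?Q)" .
  qed
  ultimately have "dim ?U = card (ind ` ?Q)"
    by (intro dim_unique[of "ind ` ?Q"]) simp_all
  then show ?thesis
    by (simp add: card_image inj)
qed

text \<open>Forwards, two sums of vertices that differ only at position \<open>i\<close> are
  compared; backwards, \<open>u\<close> is constant on each summand and hence on the sum.\<close>

lemma inner_const_on_sum_std_simplex_iff:
  fixes u :: "real ^ 'd::finite"
  assumes "finite I" and V: "\<And>i. i \<in> I \<Longrightarrow> V i \<noteq> {}"
  shows "(\<forall>x\<in>(\<Sum>i\<in>I. std_simplex (V i)). \<forall>y\<in>(\<Sum>i\<in>I. std_simplex (V i)). u \<bullet> x = u \<bullet> y)
    \<longleftrightarrow> (\<forall>i\<in>I. \<forall>a\<in>V i. \<forall>b\<in>V i. u $ a = u $ b)" (is "?lhs \<longleftrightarrow> ?rhs")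
proof
  assume L: ?lhs
  show ?rhs
  proof (intro ballI)
    fix i a b assume i: "i \<in> I" and ab: "a \<in> V i" "b \<in> V i"
    \<comment> \<open>The vertices away from \<open>i\<close> are fixed arbitrarily, so their
      contribution cancels when \<open>c\<close> varies.\<close>
    define f where "f c j = (axis (if j = i then c else SOME d. d \<in> V j) 1 :: real ^ 'd)" for c j
    have f: "sum (f c) I \<in> (\<Sum>i\<in>I. std_simplex (V i))" if "c \<in> V i" for c
      using that V \<open>finite I\<close> by (auto simp: set_sum_alt f_def some_in_eq intro!: exI[of _ "f c"])
    have "u \<bullet> sum (f c) I = u $ c + (\<Sum>j\<in>I - {i}. u $ (SOME d. d \<in> V j))" for c
      using i \<open>finite I\<close>
      by (simp add: sum.remove[of I i] f_def inner_axis inner_add_right inner_sum_right)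
    then show "u $ a = u $ b"
      using L f ab by (metis add_right_cancel)
  qed
next
  assume R: ?rhs
  have "u \<bullet> x = u \<bullet> y" if "i \<in> I" "x \<in> std_simplex (V i)" "y \<in> std_simplex (V i)" for i x y
  proof -
    obtain a where "a \<in> V i" using V \<open>i \<in> I\<close> by blast
    then show ?thesis
      using that R inner_std_simplex_eq[of x "V i" u "u $ a"] inner_std_simplex_eq[of y "V i" u "u $ a"]
      by metis
  qed
  then show ?lhs
    using \<open>finite I\<close> by (auto simp: set_sum_alt inner_sum_right intro!: sum.cong)
qed

text \<open>The vectors constant on the sum are those constant on each
  \<open>vertex_labels (F i)\<close>, equivalently on the classes, and their space has one dimension
  per class.\<close>

lemma aff_dim_sum_faces:
  fixes F :: "nat \<Rightarrow> (real ^ 'd::finite) set"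
  assumes simplex: "\<And>i. i < n \<Longrightarrow> F i = std_simplex (vertex_labels (F i))"
    and ne: "\<And>i. i < n \<Longrightarrow> F i \<noteq> {}"
  shows "aff_dim (\<Sum>i<n. F i) = int CARD('d) - int (card (face_classes n F))"
proof -
  let ?V = "\<lambda>i. vertex_labels (F i)"
  have V: "?V i \<noteq> {}" if "i < n" for i
    using simplex[OF that] ne[OF that] by fastforce
  have F: "(\<Sum>i<n. F i) = (\<Sum>i<n. std_simplex (?V i))"
    using simplex by (intro sum.cong) auto
  have ne_F: "(\<Sum>i<n. F i) \<noteq> {}"
    using ne by (auto simp: set_sum_alt intro!: bchoice)
  have iff: "(\<forall>i<n. \<forall>a\<in>?V i. \<forall>b\<in>?V i. u $ a = u $ b) \<longleftrightarrow> (\<forall>(a, b)\<in>face_equiv n F. u $ a = u $ b)"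
    for u :: "real ^ 'd"
  proof
    assume "\<forall>i<n. \<forall>a\<in>?V i. \<forall>b\<in>?V i. u $ a = u $ b"
    then have "u $ a = u $ b" if "(a, b) \<in> face_equiv n F" for a b
      using face_equiv_const[OF that, of "\<lambda>a. u $ a"] by blast
    then show "\<forall>(a, b)\<in>face_equiv n F. u $ a = u $ b" by blast
  next
    assume "\<forall>(a, b)\<in>face_equiv n F. u $ a = u $ b"
    then show "\<forall>i<n. \<forall>a\<in>?V i. \<forall>b\<in>?V i. u $ a = u $ b"
      using face_equiv.base[of _ n _ F] by blast
  qed
  have "{u. \<forall>x\<in>(\<Sum>i<n. F i). \<forall>y\<in>(\<Sum>i<n. F i). u \<bullet> x = u \<bullet> y}
      = {u. \<forall>(a, b)\<in>face_equiv n F. u $ a = u $ b}"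
    unfolding F iff[symmetric] using V
    by (intro Collect_cong, subst inner_const_on_sum_std_simplex_iff) auto
  then show ?thesis
    using aff_dim_eq_DIM_minus_dim_orthogonal[OF ne_F] dim_const_on_classes[OF equiv_face_equiv]
    by (simp add: face_classes_def)
qed

theorem proposition3p2:
  fixes n :: nat
    and L :: "nat \<Rightarrow> 'd::finite set"
    and F :: "nat \<Rightarrow> (real ^ 'd) set"
  assumes "\<And>i. i < n \<Longrightarrow> L i \<noteq> {}"
    and "\<And>i. i < n \<Longrightarrow> F i face_of std_simplex (L i)"
    and "\<And>i. i < n \<Longrightarrow> F i \<noteq> {}"
  shows "((\<Sum>i<n. F i) face_of (\<Sum>i<n. std_simplex (L i)) \<longleftrightarrow> acyclic (face_digraph n L F)) \<and>
    ((\<Sum>i<n. F i) face_of (\<Sum>i<n. std_simplex (L i)) \<longrightarrow>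
      aff_dim (\<Sum>i<n. F i) = int CARD('d) - int (card (face_classes n F)))"
proof -
  let ?V = "\<lambda>i. vertex_labels (F i)"
  note simplex = face_of_std_simplex(1)[OF assms(2)]
  have VL: "?V i \<subseteq> L i" if "i < n" for i
    using face_of_std_simplex(2)[OF assms(2)[OF that]] .
  have V: "?V i \<noteq> {}" if "i < n" for i
    using simplex[OF that] assms(3)[OF that] by fastforce
  have F: "(\<Sum>i<n. F i) = (\<Sum>i<n. std_simplex (?V i))"
    using simplex by (intro sum.cong) auto
  \<comment> \<open>The right-hand side is the potential condition of
    \<open>acyclic_face_digraph_iff\<close>, through which faces and acyclicity are matched.\<close>
  have "(\<Sum>i<n. F i) face_of (\<Sum>i<n. std_simplex (L i)) \<longleftrightarrow>
    (\<exists>w :: real ^ 'd. \<forall>i<n. \<forall>a\<in>?V i. (\<forall>b\<in>?V i. w $ a = w $ b) \<and> (\<forall>c\<in>L i - ?V i. w $ c < w $ a))"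
    (is "?face \<longleftrightarrow> ?w")
  proof
    assume ?face
    then obtain w :: "real ^ 'd" where
      "\<And>i a b. \<lbrakk>i \<in> {..<n}; a \<in> ?V i; b \<in> ?V i\<rbrakk> \<Longrightarrow> w $ a = w $ b"
      "\<And>i a c. \<lbrakk>i \<in> {..<n}; a \<in> ?V i; c \<in> L i - ?V i\<rbrakk> \<Longrightarrow> w $ c < w $ a"
      using sum_std_simplex_face_ofD[of "{..<n}" ?V L] VL V unfolding F
      by (metis finite_lessThan lessThan_iff)
    then show ?w by blast
  next
    assume ?w
    then obtain w :: "real ^ 'd" where
      w: "\<And>i a b. \<lbrakk>i < n; a \<in> ?V i; b \<in> ?V i\<rbrakk> \<Longrightarrow> w $ a = w $ b"
      "\<And>i a c. \<lbrakk>i < n; a \<in> ?V i; c \<in> L i - ?V i\<rbrakk> \<Longrightarrow> w $ c < w $ a"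
      by metis
    show ?face
      unfolding F by (rule sum_std_simplex_face_of[where w = w]) (use VL V w in \<open>blast+\<close>)
  qed
  then show ?thesis
    unfolding acyclic_face_digraph_iff using aff_dim_sum_faces[of n F, OF simplex assms(3)] by simp
qed

end
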